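(* Let $X\subset\mathbb{R}^n$ be a non-empty convex set and $\mathcal{A}\subset\mathbb{R}^n$ a non-empty finite set such that the functions $x\mapsto\exp(\alpha^Tx)$, $\alpha\in\mathcal{A}$, are linearly independent on $X$. Let $\beta\in\mathcal{A}$ and $\lambda\in\Lambda_X(\mathcal{A},\beta)$. If there exist $\beta'\in\mathcal{A}\setminus\operatorname{supp}\lambda$ and some normalized $\lambda'\in N_{\beta'}$ (i.e. $\lambda'_{\beta'}=-1$) with $(\lambda')^+\subset\operatorname{supp}\lambda$ and $\mathcal{A}\lambda'=\gamma\,\mathcal{A}\lambda$ for some $\gamma\ge0$, then $\lambda$ is not reduced.
   Context: $\mathbb{R}^{\mathcal{A}}$ is the set of real vectors indexed by $\mathcal{A}$. For $\beta\in\mathcal{A}$, $N_\beta=\{\nu\in\mathbb{R}^{\mathcal{A}} : \nu_\alpha\ge 0 \text{ for all }\alpha\in\mathcal{A}\setminus\{\beta\},\ \sum_{\alpha\in\mathcal{A}}\nu_\alpha=0\}$. For $\nu\in\mathbb{R}^{\mathcal{A}}$ write $\mathcal{A}\nu=\sum_{\alpha\in\mathcal{A}}\alpha\,\nu_\alpha\in\mathbb{R}^n$. $\sigma_X(y)=\sup\{y^Tx : x\in X\}$ is the support function. A non-zero vector $\nu^*\in N_\beta$ is an $X$-circuit (sublinear circuit of $\mathcal{A}$ with respect to $X$) if (i) $\sigma_X(-\mathcal{A}\nu^* )<\infty$, and (ii) whenever the map $\nu\mapsto\sigma_X(-\mathcal{A}\nu)$ is linear on a two-dimensional convex cone contained in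 $N_\beta$ (i.e. is finite there and coincides there with a linear function), $\nu^*$ is not in the relative interior of that cone. $\Lambda_X(\mathcal{A},\beta)$ denotes the set of $X$-circuits $\lambda\in N_\beta$ with $\lambda_\beta=-1$ (normalized), and $\Lambda_X(\mathcal{A})=\bigcup_{\beta\in\mathcal{A}}\Lambda_X(\mathcal{A},\beta)$. $\operatorname{supp}\lambda=\{\alpha\in\mathcal{A}:\lambda_\alpha\neq0\}$ and $\lambda^+=\{\alpha\in\mathcal{A}:\lambda_\alpha>0\}$. The circuit graph is the convex cone $G_X(\mathcal{A})=\operatorname{cone}\left(\{(\lambda,\sigma_X(-\mathcal{A}\lambda)) : \lambda\in\Lambda_X(\mathcal{A})\}\cup\{(\mathbf{0},1)\}\right)\subset\mathbb{R}^{\mathcal{A}}\times\mathbb{R}$ (conic hull). An $X$-circuit $\nu$ is reduced if its extended form $(\nu,\sigma_X(-\mathcal{A}\nu))$ generates an extreme ray of $G_X(\mathcal{A})$. *)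

theory Defs
  imports "HOL-Analysis.Analysis"
begin

text \<open>
  The finite non-empty set \<open>A\<close> of exponents is the range of an injective family
  \<open>a :: 'm::finite \<Rightarrow> real ^ 'n\<close>. The space of real vectors indexed by \<open>A\<close> is then \<open>real ^ 'm\<close>,
  and elements of \<open>A\<close> are referred to by their index in \<open>'m\<close>.
\<close>

definition exp_independent_on :: "(real ^ 'n) set \<Rightarrow> ('m::finite \<Rightarrow> real ^ 'n) \<Rightarrow> bool" where
  "exp_independent_on X a \<longleftrightarrow>
     (\<forall>c :: 'm \<Rightarrow> real. (\<forall>x\<in>X. (\<Sum>i\<in>UNIV. c i * exp (a i \<bullet> x)) = 0) \<longrightarrow> (\<forall>i. c i = 0))"

definition support_fun :: "(real ^ 'n) set \<Rightarrow> real ^ 'n \<Rightarrow> ereal" where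
  "support_fun X y = (SUP x\<in>X. ereal (y \<bullet> x))"

definition moment :: "('m::finite \<Rightarrow> real ^ 'n) \<Rightarrow> real ^ 'm \<Rightarrow> real ^ 'n" where
  "moment a \<nu> = (\<Sum>i\<in>UNIV. (\<nu> $ i) *\<^sub>R a i)"

definition Ncone :: "'m::finite \<Rightarrow> (real ^ 'm) set" where
  "Ncone b = {\<nu>. (\<forall>i. i \<noteq> b \<longrightarrow> 0 \<le> \<nu> $ i) \<and> (\<Sum>i\<in>UNIV. \<nu> $ i) = 0}"

text \<open>The equation with \<open>ereal (f \<nu>)\<close> includes that the support function is finite on \<open>C\<close>.\<close>

definition sigma_linear_on ::
    "(real ^ 'n) set \<Rightarrow> ('m::finite \<Rightarrow> real ^ 'n) \<Rightarrow> (real ^ 'm) set \<Rightarrow> bool" where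
  "sigma_linear_on X a C \<longleftrightarrow>
     (\<exists>f :: real ^ 'm \<Rightarrow> real. linear f \<and>
        (\<forall>\<nu>\<in>C. support_fun X (- moment a \<nu>) = ereal (f \<nu>)))"

definition circuit_at ::
    "(real ^ 'n) set \<Rightarrow> ('m::finite \<Rightarrow> real ^ 'n) \<Rightarrow> 'm \<Rightarrow> real ^ 'm \<Rightarrow> bool" where
  "circuit_at X a b \<nu> \<longleftrightarrow>
     \<nu> \<noteq> 0 \<and> \<nu> \<in> Ncone b \<and>
     support_fun X (- moment a \<nu>) < \<infinity> \<and>
     (\<forall>C. convex_cone C \<and> dim C = 2 \<and> C \<subseteq> Ncone b \<and> sigma_linear_on X a C
        \<longrightarrow> \<nu> \<notin> rel_interior C)"

definition X_circuit ::
    "(real ^ 'n) set \<Rightarrow> ('m::finite \<Rightarrow> real ^ 'n) \<Rightarrow> real ^ 'm \<Rightarrow> bool" where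
  "X_circuit X a \<nu> \<longleftrightarrow> (\<exists>b. circuit_at X a b \<nu>)"

definition normalized_circuits_at ::
    "(real ^ 'n) set \<Rightarrow> ('m::finite \<Rightarrow> real ^ 'n) \<Rightarrow> 'm \<Rightarrow> (real ^ 'm) set" where
  "normalized_circuits_at X a b = {\<nu>. circuit_at X a b \<nu> \<and> \<nu> $ b = -1}"

definition normalized_circuits ::
    "(real ^ 'n) set \<Rightarrow> ('m::finite \<Rightarrow> real ^ 'n) \<Rightarrow> (real ^ 'm) set" where
  "normalized_circuits X a = (\<Union>b. normalized_circuits_at X a b)"

definition supp :: "real ^ 'm::finite \<Rightarrow> 'm set" where
  "supp \<nu> = {i. \<nu> $ i \<noteq> 0}"

definition pos_supp :: "real ^ 'm::finite \<Rightarrow> 'm set" where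
  "pos_supp \<nu> = {i. \<nu> $ i > 0}"

text \<open>
  \<open>real_of_ereal\<close> sends infinities to 0; here it is only relevant for circuits \<open>\<nu>\<close>
  and non-empty \<open>X\<close>, where the support function is finite.
\<close>

definition extended_form ::
    "(real ^ 'n) set \<Rightarrow> ('m::finite \<Rightarrow> real ^ 'n) \<Rightarrow> real ^ 'm \<Rightarrow> (real ^ 'm) \<times> real" where
  "extended_form X a \<nu> = (\<nu>, real_of_ereal (support_fun X (- moment a \<nu>)))"

definition circuit_graph ::
    "(real ^ 'n) set \<Rightarrow> ('m::finite \<Rightarrow> real ^ 'n) \<Rightarrow> ((real ^ 'm) \<times> real) set" where
  "circuit_graph X a =
     convex_cone hull (extended_form X a ` normalized_circuits X a \<union> {(0, 1)})"

text \<open>\<open>conic hull {p}\<close> is the ray of all non-negative multiples of \<open>p\<close>.\<close>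

definition generates_extreme_ray :: "'v::real_vector \<Rightarrow> 'v set \<Rightarrow> bool" where
  "generates_extreme_ray p K \<longleftrightarrow> p \<noteq> 0 \<and> (conic hull {p}) face_of K"

definition reduced_circuit ::
    "(real ^ 'n) set \<Rightarrow> ('m::finite \<Rightarrow> real ^ 'n) \<Rightarrow> real ^ 'm \<Rightarrow> bool" where
  "reduced_circuit X a \<nu> \<longleftrightarrow>
     X_circuit X a \<nu> \<and> generates_extreme_ray (extended_form X a \<nu>) (circuit_graph X a)"

end

theory Submission
  imports Defs
begin

text \<open>
  With \<open>\<epsilon>\<close> small, \<open>\<mu> = (1 + \<epsilon> * \<gamma>) \<lambda> - \<epsilon> \<lambda>'\<close> still lies in \<open>N\<^sub>\<beta>\<close>, and the moments of \<open>\<mu>\<close> and \<open>\<lambda>'\<close>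
  are non-negative multiples of that of \<open>\<lambda>\<close>. The support function is therefore additive along
  \<open>(1 + \<epsilon> * \<gamma>) \<lambda> = \<mu> + \<epsilon> \<lambda>'\<close>, and this splits the extended form of \<open>\<lambda>\<close> inside the circuit graph,
  off the ray of \<open>\<lambda>\<close> because \<open>\<lambda>'\<close> is non-zero at \<open>\<beta>'\<close>.
  The summands lie in the circuit graph because the epigraph of \<open>\<nu> \<mapsto> \<sigma>\<^sub>X (- A \<nu>)\<close> over
  \<open>N\<^sub>b\<close> is a pointed closed convex cone: it is generated by its extremal vectors, and these are
  multiples of \<open>(0, 1)\<close> or of extended forms of circuits.
\<close>

section \<open>Convex cones: faces, compact bases, generation by extremal vectors\<close>

lemma face_of_convex_cone_summand:
  assumes "F face_of K" "convex_cone K" "conic F" "u \<in> K" "v \<in> K" "u + v \<in> F"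
  shows "u \<in> F"
proof (cases "u = v")
  case True
  have "(1/2) *\<^sub>R (u + v) \<in> F"
    using assms(3,6) by (intro conic_mul) auto
  then show ?thesis
    using True by (simp flip: scaleR_2)
next
  case False
  \<comment> \<open>A face speaks of open segments, so the sum is read as the midpoint of
    \<open>2 *\<^sub>R u\<close> and \<open>2 *\<^sub>R v\<close>. For \<open>u = v\<close> this
    segment is empty, hence the case distinction.\<close>
  have "u + v \<in> open_segment (2 *\<^sub>R u) (2 *\<^sub>R v)"
    using False unfolding in_segment by (auto intro!: exI[of _ "1/2"])
  moreover have "2 *\<^sub>R u \<in> K" "2 *\<^sub>R v \<in> K"
    using assms by (auto intro: convex_cone_scaleR)
  ultimately have "2 *\<^sub>R u \<in> F"
    using assms face_ofD by blast
  then show ?thesis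
    using conic_mul[OF assms(3), of "2 *\<^sub>R u" "1/2"] by simp
qed

text \<open>On the compact set of unit vectors of \<open>K\<close>, \<open>l\<close> attains a
  positive minimum \<open>l q\<close>. By homogeneity \<open>l p\<close> is at least
  \<open>l q * norm p\<close> on all of \<open>K\<close>, which bounds the slice.\<close>

lemma compact_base_of_closed_cone:
  fixes K :: "'v::euclidean_space set" and l :: "'v \<Rightarrow> real"
  assumes "closed K" "conic K" "linear l" and pos: "\<And>p. p \<in> K \<Longrightarrow> p \<noteq> 0 \<Longrightarrow> 0 < l p"
  shows "compact (K \<inter> {p. l p = 1})"
proof -
  have cont: "continuous_on S l" for S
    using assms(3) by (simp add: linear_continuous_on linear_conv_bounded_linear)
  have "closed {p. l p = 1}"
    using cont by (intro closed_Collect_eq) auto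
  then have closed: "closed (K \<inter> {p. l p = 1})"
    using assms(1) by blast
  have "bounded (K \<inter> {p. l p = 1})"
  proof (cases "K \<inter> sphere 0 1 = {}")
    case True
    have "K \<inter> {p. l p = 1} = {}"
    proof (rule ccontr)
      assume "K \<inter> {p. l p = 1} \<noteq> {}"
      then obtain p where "p \<in> K" "p \<noteq> 0"
        using linear_0[OF assms(3)] by force
      then have "(1 / norm p) *\<^sub>R p \<in> K \<inter> sphere 0 1"
        using assms(2) by (auto intro: conic_mul)
      with True show False by blast
    qed
    then show ?thesis by (metis bounded_empty)
  next
    case False
    have "compact (K \<inter> sphere 0 1)"
      using assms(1) by (simp add: closed_Int_compact)
    then obtain q where q: "q \<in> K \<inter> sphere 0 1" "\<And>p. p \<in> K \<inter> sphere 0 1 \<Longrightarrow> l q \<le> l p"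
      using continuous_attains_inf[OF _ False cont] by blast
    have "q \<noteq> 0"
      using q(1) by auto
    then have lq: "0 < l q"
      using q(1) pos by auto
    have "norm p \<le> 1 / l q" if "p \<in> K" "l p = 1" for p
    proof -
      have "p \<noteq> 0"
        using that linear_0[OF assms(3)] by auto
      then have "(1 / norm p) *\<^sub>R p \<in> K \<inter> sphere 0 1"
        using assms(2) that by (auto intro: conic_mul)
      then have "l q \<le> l ((1 / norm p) *\<^sub>R p)"
        by (rule q(2))
      also have "\<dots> = 1 / norm p"
        using linear_scale[OF assms(3), of "1 / norm p" p] that(2) by simp
      finally show ?thesis
        using lq \<open>p \<noteq> 0\<close> by (simp add: field_simps)
    qed
    then show ?thesis
      by (auto simp: bounded_iff)
  qed
  with closed show ?thesis
    by (simp add: compact_eq_bounded_closed)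
qed

text \<open>The generator of an extreme ray, phrased with sums instead of segments. A condition on
  \<open>u\<close> alone suffices because \<open>u\<close> and \<open>v\<close> can be
  exchanged.\<close>

definition extremal_in :: "'v::real_vector \<Rightarrow> 'v set \<Rightarrow> bool" where
  "extremal_in p K \<longleftrightarrow>
     p \<in> K \<and> p \<noteq> 0 \<and> (\<forall>u\<in>K. \<forall>v\<in>K. u + v = p \<longrightarrow> u \<in> conic hull {p})"

text \<open>Two non-zero summands of \<open>p\<close>, rescaled to the slice \<open>l = 1\<close>,
  have \<open>p\<close> as a convex combination with weights \<open>l u\<close> and
  \<open>l v\<close>. Extremity of \<open>p\<close> then makes both rescaled points equal to
  \<open>p\<close>.\<close>

lemma extreme_point_of_base_extremal:
  assumes "convex_cone K" "linear l" and pos: "\<And>p. p \<in> K \<Longrightarrow> p \<noteq> 0 \<Longrightarrow> (0::real) < l p"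
    and p: "p extreme_point_of (K \<inter> {p. l p = 1})"
  shows "extremal_in p K"
proof -
  have p1: "p \<in> K" "l p = 1"
    using p by (auto simp: extreme_point_of_def)
  have "u \<in> conic hull {p}" if uv: "u \<in> K" "v \<in> K" "u + v = p" for u v
  proof (cases "u = 0 \<or> v = 0")
    case True
    then show ?thesis
      using uv(3) by (auto simp: hull_inc)
  next
    case False
    then have l: "0 < l u" "0 < l v"
      using pos uv by auto
    have sum: "l u + l v = 1"
      using linear_add[OF assms(2), of u v] uv(3) p1(2) by simp
    define u' v' where "u' = (1 / l u) *\<^sub>R u" and "v' = (1 / l v) *\<^sub>R v"
    have mem: "u' \<in> K \<inter> {p. l p = 1}" "v' \<in> K \<inter> {p. l p = 1}"
      using l uv assms(1,2) linear_scale[OF assms(2)]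
      unfolding u'_def v'_def by (auto intro: convex_cone_scaleR)
    have "1 - l v = l u"
      using sum by simp
    then have comb: "p = (1 - l v) *\<^sub>R u' + l v *\<^sub>R v'"
      using l uv(3) by (simp add: u'_def v'_def)
    have "u' = v'"
    proof (rule ccontr)
      assume "u' \<noteq> v'"
      then have "p \<in> open_segment u' v'"
        unfolding in_segment using comb l sum by (intro conjI exI[of _ "l v"]) auto
      with mem p show False
        by (auto simp: extreme_point_of_def)
    qed
    then have "u' = p"
      using comb by (simp flip: scaleR_left_distrib)
    then have "u = l u *\<^sub>R p"
      using l by (auto simp: u'_def)
    then show ?thesis
      using l by (auto simp: conic_hull_explicit intro: exI[of _ "l u"])
  qed
  then show ?thesis
    using p1 linear_0[OF assms(2)] by (auto simp: extremal_in_def)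
qed

text \<open>The slice \<open>l = 1\<close> is compact and convex, hence the convex hull of its
  extreme points by Krein-Milman, and every non-zero element of \<open>K\<close> is a positive
  multiple of a point of the slice.\<close>

lemma closed_pointed_cone_generated_by_extremal:
  fixes K :: "'v::euclidean_space set" and l :: "'v \<Rightarrow> real"
  assumes "closed K" "convex_cone K" "linear l" and pos: "\<And>p. p \<in> K \<Longrightarrow> p \<noteq> 0 \<Longrightarrow> 0 < l p"
    and H: "convex_cone H" "\<And>p. extremal_in p K \<Longrightarrow> p \<in> H"
  shows "K \<subseteq> H"
proof
  let ?B = "K \<inter> {p. l p = 1}"
  fix p assume p: "p \<in> K"
  show "p \<in> H"
  proof (cases "p = 0")
    case True
    then show ?thesis
      using H(1) convex_cone_contains_0 by blast
  next
    case False
    then have lp: "0 < l p"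
      using pos p by blast
    have "compact ?B"
      using assms by (intro compact_base_of_closed_cone) (auto simp: convex_cone_def)
    moreover have "convex {p. l p = 1}"
      using convex_linear_vimage[OF assms(3), of "{1}"] by (simp add: vimage_def)
    then have "convex ?B"
      using assms(2) by (auto simp: convex_cone_def intro: convex_Int)
    ultimately have "?B = convex hull {x. x extreme_point_of ?B}"
      by (rule Krein_Milman_Minkowski)
    also have "\<dots> \<subseteq> H"
    proof (rule hull_minimal)
      show "{x. x extreme_point_of ?B} \<subseteq> H"
        using extreme_point_of_base_extremal[OF assms(2,3) pos] H(2) by blast
      show "convex H"
        using H(1) by (simp add: convex_cone_def)
    qed
    finally have "?B \<subseteq> H" .
    moreover have "(1 / l p) *\<^sub>R p \<in> ?B"
      using p lp assms(2) linear_scale[OF assms(3)] by (auto intro: convex_cone_scaleR)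
    ultimately show ?thesis
      using convex_cone_scaleR[OF H(1), of "l p" "(1 / l p) *\<^sub>R p"] lp by auto
  qed
qed

section \<open>Moments, support functions and the cones \<open>Ncone b\<close>\<close>

lemma linear_moment: "linear (moment a)"
  unfolding moment_def by (rule linearI) (auto simp: algebra_simps sum.distrib scaleR_sum_right)

lemma support_fun_le_iff: "support_fun X y \<le> ereal t \<longleftrightarrow> (\<forall>x\<in>X. y \<bullet> x \<le> t)"
  by (simp add: support_fun_def SUP_le_iff)

lemma support_fun_scaleR:
  assumes "X \<noteq> {}" "0 \<le> c" "support_fun X y = ereal s"
  shows "support_fun X (c *\<^sub>R y) = ereal (c * s)"
proof -
  have "support_fun X (c *\<^sub>R y) = (SUP x\<in>X. ereal c * ereal (y \<bullet> x))"
    by (simp add: support_fun_def)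
  also have "\<dots> = ereal c * (SUP x\<in>X. ereal (y \<bullet> x))"
    using assms by (intro Sup_ereal_mult_left'[symmetric]) auto
  finally show ?thesis
    using assms(3) by (simp add: support_fun_def)
qed

lemma support_fun_finite:
  assumes "X \<noteq> {}" "support_fun X y < \<infinity>"
  obtains s where "support_fun X y = ereal s"
proof -
  obtain x where "x \<in> X"
    using assms(1) by blast
  then have "ereal (y \<bullet> x) \<le> support_fun X y"
    unfolding support_fun_def by (rule SUP_upper)
  then show ?thesis
    using assms(2) that by (cases "support_fun X y") auto
qed

lemma Ncone_convex_cone: "convex_cone (Ncone b)"
  by (auto simp: convex_cone_iff Ncone_def sum.distrib simp flip: sum_distrib_left)

lemma Ncone_closed: "closed (Ncone b)"
  unfolding Ncone_def
  by (intro closed_Collect_conj closed_Collect_all closed_Collect_imp open_Collect_const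
      closed_Collect_le closed_Collect_eq continuous_intros)

text \<open>Otherwise all entries would be non-negative with sum zero. This makes
  \<open>Ncone b\<close> pointed and allows scaling to entry -1 at \<open>b\<close>.\<close>

lemma Ncone_neg_at:
  assumes "\<nu> \<in> Ncone b" "\<nu> \<noteq> 0"
  shows "\<nu> $ b < 0"
proof (rule ccontr)
  assume "\<not> \<nu> $ b < 0"
  then have nonneg: "0 \<le> \<nu> $ i" for i
    using assms(1) by (cases "i = b") (auto simp: Ncone_def)
  moreover have "(\<Sum>i\<in>UNIV. \<nu> $ i) = 0"
    using assms(1) by (simp add: Ncone_def)
  ultimately have "\<nu> = 0"
    by (simp add: sum_nonneg_eq_0_iff vec_eq_iff)
  with assms(2) show False by simp
qed

section \<open>The epigraph of the support function over \<open>Ncone b\<close>\<close>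

definition sigma_epigraph ::
    "(real ^ 'n) set \<Rightarrow> ('m::finite \<Rightarrow> real ^ 'n) \<Rightarrow> 'm \<Rightarrow> ((real ^ 'm) \<times> real) set" where
  "sigma_epigraph X a b =
     {p. fst p \<in> Ncone b \<and> support_fun X (- moment a (fst p)) \<le> ereal (snd p)}"

text \<open>Trades the extended-real bound for one homogeneous linear inequality per point of
  \<open>X\<close>; the cone property and closedness are then read off an intersection of closed
  half-spaces with a closed cone.\<close>

lemma sigma_epigraph_iff:
  "p \<in> sigma_epigraph X a b \<longleftrightarrow>
     fst p \<in> Ncone b \<and> (\<forall>x\<in>X. - moment a (fst p) \<bullet> x \<le> snd p)"
  by (simp add: sigma_epigraph_def support_fun_le_iff)

lemma sigma_epigraph_convex_cone: "convex_cone (sigma_epigraph X a b)"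
  unfolding convex_cone_iff
proof (intro conjI ballI allI impI)
  show "0 \<in> sigma_epigraph X a b"
    using convex_cone_contains_0[OF Ncone_convex_cone[of b]]
    by (simp add: sigma_epigraph_iff linear_0[OF linear_moment])
next
  fix p q assume "p \<in> sigma_epigraph X a b" "q \<in> sigma_epigraph X a b"
  then show "p + q \<in> sigma_epigraph X a b"
    using convex_cone_add[OF Ncone_convex_cone[of b]]
    by (force simp: sigma_epigraph_iff linear_add[OF linear_moment] inner_simps)
next
  fix p and c :: real assume p: "p \<in> sigma_epigraph X a b" and "0 \<le> c"
  then have "c * (- moment a (fst p) \<bullet> x) \<le> c * snd p" if "x \<in> X" for x
    using that mult_left_mono[of "- moment a (fst p) \<bullet> x" "snd p" c]
    by (simp add: sigma_epigraph_iff)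
  then show "c *\<^sub>R p \<in> sigma_epigraph X a b"
    using p \<open>0 \<le> c\<close> convex_cone_scaleR[OF Ncone_convex_cone[of b]]
    by (simp add: sigma_epigraph_iff linear_scale[OF linear_moment])
qed

lemma sigma_epigraph_closed: "closed (sigma_epigraph X a b)"
proof -
  have moment: "continuous_on UNIV (\<lambda>p::(real^'m::finite) \<times> real. moment a (fst p))" for a :: "'m::finite \<Rightarrow> real^'n"
    unfolding moment_def by (intro continuous_intros)
  have "sigma_epigraph X a b =
      fst -` Ncone b \<inter> (\<Inter>x\<in>X. {p. - moment a (fst p) \<bullet> x \<le> snd p})"
    by (auto simp: sigma_epigraph_iff)
  moreover have "closed (fst -` Ncone b :: ((real^'m::finite) \<times> real) set)" for b :: "'m::finite"
    using Ncone_closed by (rule closed_vimage_fst)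
  moreover have "closed {p::(real^'m::finite) \<times> real. - moment a (fst p) \<bullet> x \<le> snd p}"
    for a :: "'m::finite \<Rightarrow> real^'n" and x
    using moment by (intro closed_Collect_le continuous_intros)
  ultimately show ?thesis
    by (auto intro!: closed_Int closed_INT)
qed

lemma sigma_epigraph_positive_functional:
  assumes "X \<noteq> {}"
  obtains l where "linear l" "\<And>p. p \<in> sigma_epigraph X a b \<Longrightarrow> p \<noteq> 0 \<Longrightarrow> (0::real) < l p"
proof -
  obtain x where x: "x \<in> X"
    using assms by blast
  \<comment> \<open>The first two terms are the slack of the epigraph inequality at
    \<open>x\<close>, which is non-negative but may vanish. The last term adds a strictly positive
    amount unless \<open>fst p = 0\<close>.\<close>
  define l where "l = (\<lambda>p. snd p + moment a (fst p) \<bullet> x - fst p $ b)"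
  show thesis
  proof (rule that)
    show "linear l"
      unfolding l_def
      by (rule linearI)
        (auto simp: linear_add[OF linear_moment] linear_scale[OF linear_moment] algebra_simps)
    fix p assume p: "p \<in> sigma_epigraph X a b" "p \<noteq> 0"
    then have le: "0 \<le> snd p + moment a (fst p) \<bullet> x"
      using x by (force simp: sigma_epigraph_iff)
    show "0 < l p"
    proof (cases "fst p = 0")
      case True
      then have "snd p \<noteq> 0"
        using p(2) by (auto simp: prod_eq_iff)
      then show ?thesis
        using le True by (simp add: l_def linear_0[OF linear_moment])
    next
      case False
      then have "fst p $ b < 0"
        using p(1) by (intro Ncone_neg_at) (auto simp: sigma_epigraph_iff)
      then show ?thesis
        using le by (simp add: l_def)
    qed
  qed
qed

section \<open>From extremal vectors of the epigraph to circuits\<close>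

lemma extremal_sigma_epigraph_circuit:
  assumes "X \<noteq> {}" and extr: "extremal_in (\<nu>, s) (sigma_epigraph X a b)" and "\<nu> \<noteq> 0"
  shows "support_fun X (- moment a \<nu>) = ereal s"
    and "circuit_at X a b ((1 / - (\<nu> $ b)) *\<^sub>R \<nu>)"
proof -
  let ?E = "sigma_epigraph X a b"
  have mem: "\<nu> \<in> Ncone b" "support_fun X (- moment a \<nu>) \<le> ereal s"
    using extr by (auto simp: extremal_in_def sigma_epigraph_def)
  then obtain t where t: "support_fun X (- moment a \<nu>) = ereal t"
    using support_fun_finite[OF assms(1), of "- moment a \<nu>"] by (metis ereal_less_PInfty le_less_trans)
  \<comment> \<open>An extremal vector with \<open>\<nu>\<close> non-zero lies on the graph:
    otherwise the vertical vector \<open>(0, s - t)\<close> could be split off.\<close>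
  have vertical: "(0, s - t) \<in> ?E"
    using mem t convex_cone_contains_0[OF Ncone_convex_cone[of b]]
    by (auto simp: sigma_epigraph_iff linear_0[OF linear_moment])
  have "(\<nu>, t) \<in> ?E"
    using mem t by (simp add: sigma_epigraph_def)
  with vertical extr have "(0, s - t) \<in> conic hull {(\<nu>, s)}"
    by (force simp: extremal_in_def)
  with \<open>\<nu> \<noteq> 0\<close> have "s = t"
    by (auto simp: conic_hull_explicit)
  with t show sigma: "support_fun X (- moment a \<nu>) = ereal s"
    by simp
  have neg: "\<nu> $ b < 0"
    using mem(1) \<open>\<nu> \<noteq> 0\<close> by (rule Ncone_neg_at)
  define c where "c = 1 / - (\<nu> $ b)"
  have c: "0 < c"
    using neg by (simp add: c_def)
  define \<mu> where "\<mu> = c *\<^sub>R \<nu>"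
  have \<nu>\<mu>: "\<nu> = (1 / c) *\<^sub>R \<mu>"
    using c by (simp add: \<mu>_def)
  have sigma_\<mu>: "support_fun X (- moment a \<mu>) = ereal (c * s)"
    using support_fun_scaleR[OF assms(1) _ sigma, of c] c
    by (simp add: \<mu>_def linear_scale[OF linear_moment])
  have "\<mu> \<notin> rel_interior C"
    if C: "convex_cone C" "dim C = 2" "C \<subseteq> Ncone b" "sigma_linear_on X a C" for C
  proof
    assume rel: "\<mu> \<in> rel_interior C"
    obtain f where f: "linear f" "\<And>\<nu>. \<nu> \<in> C \<Longrightarrow> support_fun X (- moment a \<nu>) = ereal (f \<nu>)"
      using C(4) by (auto simp: sigma_linear_on_def)
    have "\<not> C \<subseteq> span {\<mu>}"
    proof
      assume "C \<subseteq> span {\<mu>}"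
      then have "dim C \<le> card {\<mu>}"
        by (intro dim_le_card) auto
      with C(2) show False by simp
    qed
    then obtain w where w: "w \<in> C" "w \<notin> span {\<mu>}"
      by blast
    \<comment> \<open>As \<open>\<mu>\<close> is relatively interior, the segment from
      \<open>w\<close> to \<open>\<mu>\<close> can be prolonged beyond \<open>\<mu>\<close> within
      \<open>C\<close>.\<close>
    obtain e where e: "e > 1" "(1 - e) *\<^sub>R w + e *\<^sub>R \<mu> \<in> C"
      using rel w(1) C(1) convex_rel_interior_iff[of C \<mu>] by (auto simp: convex_cone_def)
    \<comment> \<open>The coefficients make the multiples of \<open>w\<close> cancel in
      \<open>u + v\<close>, leaving \<open>(1 / c) *\<^sub>R \<mu>\<close>, which is
      \<open>\<nu>\<close>.\<close>
    define u v where "u = ((e - 1) / (e * c)) *\<^sub>R w"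
      and "v = (1 / (e * c)) *\<^sub>R ((1 - e) *\<^sub>R w + e *\<^sub>R \<mu>)"
    have uv: "u \<in> C" "v \<in> C"
      using w(1) e c C(1) unfolding u_def v_def by (auto intro!: convex_cone_scaleR)
    have sum: "u + v = \<nu>"
      using e c unfolding u_def v_def \<nu>\<mu> by (simp add: algebra_simps divide_simps flip: scaleR_left_distrib)
    have "\<nu> \<in> C"
      using sum uv C(1) convex_cone_add by blast
    then have "f \<nu> = s"
      using f(2) sigma by auto
    then have "f u + f v = s"
      using linear_add[OF f(1)] sum by metis
    \<comment> \<open>Linearity of \<open>f\<close> makes these two graph points add up to
      \<open>(\<nu>, s)\<close>. Extremality puts \<open>u\<close>, and with it \<open>w\<close>, on
      the line of \<open>\<mu>\<close>, against the choice of \<open>w\<close>.\<close>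
    moreover have "(u, f u) \<in> ?E" "(v, f v) \<in> ?E"
      using uv C(3) f(2) by (auto simp: sigma_epigraph_def)
    ultimately have "(u, f u) \<in> conic hull {(\<nu>, s)}"
      using extr sum unfolding extremal_in_def by (metis add_Pair)
    then obtain d where "u = d *\<^sub>R \<nu>"
      by (auto simp: conic_hull_explicit)
    moreover have "w = (e * c / (e - 1)) *\<^sub>R u"
      using e c by (simp add: u_def)
    ultimately have "w \<in> span {\<mu>}"
      by (simp add: \<nu>\<mu> span_base span_scale)
    with w(2) show False by blast
  qed
  moreover have "\<mu> \<noteq> 0" "\<mu> \<in> Ncone b"
    using c \<open>\<nu> \<noteq> 0\<close> mem(1) convex_cone_scaleR[OF Ncone_convex_cone[of b]] by (auto simp: \<mu>_def)
  ultimately show "circuit_at X a b ((1 / - (\<nu> $ b)) *\<^sub>R \<nu>)"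
    using sigma_\<mu> by (auto simp: circuit_at_def \<mu>_def c_def)
qed

lemma circuit_graph_convex_cone: "convex_cone (circuit_graph X a)"
  unfolding circuit_graph_def by (rule convex_cone_convex_cone_hull)

text \<open>Gives membership in the circuit graph for any vector of \<open>Ncone b\<close> with
  finite support value, without an explicit decomposition into circuits.\<close>

lemma sigma_epigraph_subset_circuit_graph:
  assumes "X \<noteq> {}"
  shows "sigma_epigraph X a b \<subseteq> circuit_graph X a"
proof -
  obtain l where l: "linear l" "\<And>p. p \<in> sigma_epigraph X a b \<Longrightarrow> p \<noteq> 0 \<Longrightarrow> (0::real) < l p"
    using sigma_epigraph_positive_functional[OF assms] by blast
  show ?thesis
  proof (rule closed_pointed_cone_generated_by_extremal
      [OF sigma_epigraph_closed sigma_epigraph_convex_cone l circuit_graph_convex_cone])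
    fix p assume extr: "extremal_in p (sigma_epigraph X a b)"
    obtain \<nu> s where p: "p = (\<nu>, s)"
      by force
    have mem: "(\<nu>, s) \<in> sigma_epigraph X a b"
      using extr p by (simp add: extremal_in_def)
    show "p \<in> circuit_graph X a"
    proof (cases "\<nu> = 0")
      case True
      then have "0 \<le> s"
        using mem assms by (auto simp: sigma_epigraph_iff linear_0[OF linear_moment])
      moreover have "(0, 1) \<in> circuit_graph X a"
        unfolding circuit_graph_def by (rule hull_inc) simp
      ultimately have "s *\<^sub>R (0, 1) \<in> circuit_graph X a"
        using circuit_graph_convex_cone convex_cone_scaleR by blast
      then show ?thesis
        using p True by simp
    next
      case False
      define c where "c = 1 / - (\<nu> $ b)"
      have c: "0 < c" "c * (\<nu> $ b) = -1"
        using Ncone_neg_at[of \<nu> b] False mem by (auto simp: c_def sigma_epigraph_iff)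
      note circuit = extremal_sigma_epigraph_circuit[OF assms extr[unfolded p] False, folded c_def]
      have "support_fun X (- moment a (c *\<^sub>R \<nu>)) = ereal (c * s)"
        using support_fun_scaleR[OF assms _ circuit(1), of c] c
        by (simp add: linear_scale[OF linear_moment])
      then have "extended_form X a (c *\<^sub>R \<nu>) = c *\<^sub>R p"
        by (simp add: extended_form_def p)
      moreover have "c *\<^sub>R \<nu> \<in> normalized_circuits X a"
        using circuit(2) c(2) by (auto simp: normalized_circuits_def normalized_circuits_at_def)
      ultimately have "c *\<^sub>R p \<in> circuit_graph X a"
        unfolding circuit_graph_def by (intro hull_inc) (metis UnI1 image_eqI)
      then show ?thesis
        using convex_cone_scaleR[OF circuit_graph_convex_cone, of "1 / c" "c *\<^sub>R p"] c by simp
    qed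
  qed
qed

section \<open>Splitting the extended form of \<open>lam\<close>\<close>

theorem theorem6p2:
  fixes X :: "(real ^ 'n) set"
    and a :: "'m::finite \<Rightarrow> real ^ 'n"
    and \<beta> :: 'm
    and lam :: "real ^ 'm"
  assumes "X \<noteq> {}" and "convex X"
    and "inj a"
    and "exp_independent_on X a"
    and "lam \<in> normalized_circuits_at X a \<beta>"
    and "\<exists>\<beta>' lam' \<gamma>. \<beta>' \<notin> supp lam \<and> lam' \<in> Ncone \<beta>' \<and> lam' $ \<beta>' = -1 \<and>
           pos_supp lam' \<subseteq> supp lam \<and> 0 \<le> \<gamma> \<and> moment a lam' = \<gamma> *\<^sub>R moment a lam"
  shows "\<not> reduced_circuit X a lam"
proof
  assume "reduced_circuit X a lam"
  then have face: "(conic hull {extended_form X a lam}) face_of circuit_graph X a"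
    by (simp add: reduced_circuit_def generates_extreme_ray_def)
  have lam: "lam \<in> Ncone \<beta>" "lam $ \<beta> = -1" "support_fun X (- moment a lam) < \<infinity>"
    using assms(5) by (auto simp: normalized_circuits_at_def circuit_at_def)
  obtain s where s: "support_fun X (- moment a lam) = ereal s"
    using support_fun_finite[OF assms(1) lam(3)] .
  then have ext: "extended_form X a lam = (lam, s)"
    by (simp add: extended_form_def)
  obtain \<beta>' lam' \<gamma> where \<beta>': "\<beta>' \<notin> supp lam" and lam': "lam' \<in> Ncone \<beta>'" "lam' $ \<beta>' = -1"
    "pos_supp lam' \<subseteq> supp lam" and \<gamma>: "0 \<le> \<gamma>" "moment a lam' = \<gamma> *\<^sub>R moment a lam"
    using assms(6) by blast
  have lam_nonneg: "0 \<le> lam $ i" if "i \<noteq> \<beta>" for i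
    using lam(1) that by (auto simp: Ncone_def)
  have lam'_nonpos: "lam' $ i \<le> 0" if "lam $ i = 0" for i
    using lam'(3) that by (force simp: pos_supp_def supp_def)

  obtain \<epsilon> where \<epsilon>: "0 < \<epsilon>" "\<And>i. i \<noteq> \<beta> \<Longrightarrow> \<epsilon> * (lam' $ i) \<le> lam $ i"
  proof
    \<comment> \<open>Where \<open>lam\<close> is positive, the summand 1 in the denominator keeps
      the quotient defined even if \<open>lam'\<close> vanishes. Where \<open>lam\<close> is zero,
      \<open>lam'\<close> is at most zero and any positive value works, so 1 serves as a
      filler.\<close>
    define \<epsilon> where "\<epsilon> = Min ((\<lambda>i. if lam $ i > 0 then lam $ i / (1 + \<bar>lam' $ i\<bar>) else 1) ` UNIV)"
    show "0 < \<epsilon>"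
      unfolding \<epsilon>_def by (subst Min_gr_iff) (auto intro!: divide_pos_pos)
    fix i assume i: "i \<noteq> \<beta>"
    show "\<epsilon> * (lam' $ i) \<le> lam $ i"
    proof (cases "lam $ i = 0")
      case True
      then show ?thesis
        using lam'_nonpos \<open>0 < \<epsilon>\<close> by (auto simp: mult_nonneg_nonpos)
    next
      case False
      then have pos: "lam $ i > 0"
        using lam_nonneg i by force
      have "\<epsilon> \<le> (if lam $ i > 0 then lam $ i / (1 + \<bar>lam' $ i\<bar>) else 1)"
        unfolding \<epsilon>_def by (rule Min_le) auto
      then have "\<epsilon> * (1 + \<bar>lam' $ i\<bar>) \<le> lam $ i"
        using pos by (simp add: pos_le_divide_eq)
      moreover have "\<epsilon> * (lam' $ i) \<le> \<epsilon> * (1 + \<bar>lam' $ i\<bar>)"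
        using \<open>0 < \<epsilon>\<close> by (intro mult_left_mono) auto
      ultimately show ?thesis by simp
    qed
  qed
  \<comment> \<open>The factor \<open>1 + \<epsilon> * \<gamma>\<close> compensates the moment
    \<open>\<epsilon> * \<gamma>\<close> times that of \<open>lam\<close> removed with
    \<open>\<epsilon> *\<^sub>R lam'\<close>. So \<open>\<mu>\<close> has the moment of
    \<open>lam\<close> and the same support value \<open>s\<close>.\<close>
  define \<mu> where "\<mu> = (1 + \<epsilon> * \<gamma>) *\<^sub>R lam - \<epsilon> *\<^sub>R lam'"
  have "\<mu> \<in> Ncone \<beta>"
  proof -
    have "(\<Sum>i\<in>UNIV. \<mu> $ i) = 0"
      using lam(1) lam'(1) by (simp add: \<mu>_def Ncone_def sum_subtractf flip: sum_distrib_left)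
    moreover have "0 \<le> \<mu> $ i" if "i \<noteq> \<beta>" for i
    proof -
      have "0 \<le> \<epsilon> * \<gamma> * (lam $ i)"
        using \<epsilon>(1) \<gamma>(1) lam_nonneg[OF that] by simp
      then show ?thesis
        using \<epsilon>(2)[OF that] by (simp add: \<mu>_def algebra_simps)
    qed
    ultimately show ?thesis
      by (simp add: Ncone_def)
  qed
  moreover have "moment a \<mu> = moment a lam"
    by (simp add: \<mu>_def linear_diff[OF linear_moment] linear_add[OF linear_moment]
        linear_scale[OF linear_moment] \<gamma>(2) scaleR_left_distrib)
  ultimately have \<mu>_mem: "(\<mu>, s) \<in> circuit_graph X a"
    using s sigma_epigraph_subset_circuit_graph[OF assms(1), of a \<beta>] by (auto simp: sigma_epigraph_def)
  have "support_fun X (- moment a lam') = ereal (\<gamma> * s)"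
    using support_fun_scaleR[OF assms(1) \<gamma>(1) s] by (simp add: \<gamma>(2))
  then have "(lam', \<gamma> * s) \<in> circuit_graph X a"
    using lam'(1) sigma_epigraph_subset_circuit_graph[OF assms(1), of a \<beta>']
    by (auto simp: sigma_epigraph_def)
  then have lam'_mem: "\<epsilon> *\<^sub>R (lam', \<gamma> * s) \<in> circuit_graph X a"
    using \<epsilon>(1) circuit_graph_convex_cone by (intro convex_cone_scaleR) auto
  have "\<epsilon> *\<^sub>R (lam', \<gamma> * s) + (\<mu>, s) = (1 + \<epsilon> * \<gamma>) *\<^sub>R (lam, s)"
    by (simp add: \<mu>_def algebra_simps)
  moreover have "(1 + \<epsilon> * \<gamma>) *\<^sub>R (lam, s) \<in> conic hull {(lam, s)}"
    using \<epsilon>(1) \<gamma>(1) by (intro conic_mul conic_conic_hull hull_inc) auto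
  ultimately have "\<epsilon> *\<^sub>R (lam', \<gamma> * s) \<in> conic hull {(lam, s)}"
    using face_of_convex_cone_summand[OF face[unfolded ext] circuit_graph_convex_cone
        conic_conic_hull lam'_mem \<mu>_mem] by simp
  then obtain d where "\<epsilon> *\<^sub>R lam' = d *\<^sub>R lam"
    by (auto simp: conic_hull_explicit)
  \<comment> \<open>At \<open>\<beta>'\<close> the left side is \<open>- \<epsilon>\<close>, while
    the right side is zero because \<open>\<beta>'\<close> is outside the support of
    \<open>lam\<close>.\<close>
  then have "\<epsilon> * lam' $ \<beta>' = d * lam $ \<beta>'"
    by (metis vector_scaleR_component real_scaleR_def)
  then show False
    using \<epsilon>(1) \<beta>' lam'(2) by (simp add: supp_def)
qed

end
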